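(* Let $K$ and $L$ be finite simplicial complexes and let $f\colon K\to L$ be a non-degenerate simplicial map. Let $\mathrm{sk}_1K$ and $\mathrm{sk}_1L$ be the one-dimensional skeletons of $K$ and $L$, and let $f|_{\mathrm{sk}_1K}\colon\mathrm{sk}_1K\to\mathrm{sk}_1L$ be the restriction of $f$. Then the piecewise linear map $|f|\colon|K|\to|L|$ lifts to an embedding if and only if $\left|f|_{\mathrm{sk}_1K}\right|\colon|\mathrm{sk}_1K|\to|\mathrm{sk}_1L|$ lifts to an embedding. Moreover, there is a bijection between the isotopy classes of liftings of $|f|$ and the isotopy classes of liftings of $\left|f|_{\mathrm{sk}_1K}\right|$.
   Context: $|K|$ denotes the geometric realisation of $K$, and $|f|$ the piecewise linear map induced by a simplicial map $f$. A simplicial map $f$ between finite complexes is non-degenerate if it is injective on each simplex (equivalently, $|f|$ has finite point preimages). A piecewise linear map $\varphi\colon P\to Q$ of polyhedra lifts to an embedding if there is a piecewise linear embedding $\widetilde{\varphi}\colon P\to Q\times\mathbb{R}$ with $\varphi=\mathrm{pr}_Q\circ\widetilde{\varphi}$; such $\widetilde\varphi$ is called a lifting of $\varphi$. Two liftings are isotopic if they are connected by an isotopy through liftings, i.e. a continuous map $F\colon P\times[0,1]\to Q\times\mathbb{R}$ such that each $F(\cdot,t)$ is a lifting of $\varphi$ and $F(\cdot,0)$, $F(\cdot,1)$ are the given liftings. *)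

theory Defs
  imports "HOL-Analysis.Analysis"
begin

text \<open>
  Finite simplicial complexes are those of \<^const>\<open>simplicial_complex\<close>: finite sets of simplices in
  a Euclidean space, the empty simplex being allowed as a member. The realisation \<open>|K|\<close> is
  the polyhedron \<open>\<Union>K\<close>.
\<close>

definition vertex_sets :: "'a::euclidean_space set set \<Rightarrow> 'a set set" where
  "vertex_sets K = {C. finite C \<and> \<not> affine_dependent C \<and> convex hull C \<in> K}"

definition complex_vertices :: "'a::euclidean_space set set \<Rightarrow> 'a set" where
  "complex_vertices K = {v. {v} \<in> K}"

definition skeleton :: "nat \<Rightarrow> 'a::euclidean_space set set \<Rightarrow> 'a set set" where
  "skeleton n K = {S \<in> K. aff_dim S \<le> int n}"

text \<open>
  A simplicial map is given by its values on vertices; values of the underlying total function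
  elsewhere play no role.
\<close>

definition simplicial_map ::
  "'a::euclidean_space set set \<Rightarrow> 'b::euclidean_space set set \<Rightarrow> ('a \<Rightarrow> 'b) \<Rightarrow> bool" where
  "simplicial_map K L f \<longleftrightarrow> (\<forall>C\<in>vertex_sets K. f ` C \<in> vertex_sets L)"

definition nondegenerate :: "'a::euclidean_space set set \<Rightarrow> ('a \<Rightarrow> 'b) \<Rightarrow> bool" where
  "nondegenerate K f \<longleftrightarrow> (\<forall>C\<in>vertex_sets K. inj_on f C)"

definition barycentric_coords ::
  "'a::euclidean_space set set \<Rightarrow> 'a \<Rightarrow> ('a \<Rightarrow> real) \<Rightarrow> bool" where
  "barycentric_coords K x u \<longleftrightarrow>
     (\<exists>C\<in>vertex_sets K. (\<forall>v. v \<notin> C \<longrightarrow> u v = 0) \<and> (\<forall>v\<in>C. 0 \<le> u v) \<and>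
        sum u C = 1 \<and> (\<Sum>v\<in>C. u v *\<^sub>R v) = x)"

text \<open>
  The map \<open>|f|\<close>, meaningful on \<open>\<Union>K\<close>: barycentric coordinates of a point with respect to a
  simplicial complex are unique.
\<close>

definition realization ::
  "'a::euclidean_space set set \<Rightarrow> ('a \<Rightarrow> 'b::euclidean_space) \<Rightarrow> 'a \<Rightarrow> 'b" where
  "realization K f x =
     (\<Sum>v\<in>complex_vertices K. (THE u. barycentric_coords K x u) v *\<^sub>R f v)"

text \<open>
  Piecewise linear means affine on every simplex of some triangulation of the domain, which is
  thereby a compact polyhedron. The codomain need not be compact, as it will be \<open>Q \<times> \<real>\<close>.
\<close>

definition pl_map ::
  "'a::euclidean_space set \<Rightarrow> 'b::euclidean_space set \<Rightarrow> ('a \<Rightarrow> 'b) \<Rightarrow> bool" where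
  "pl_map P Q \<phi> \<longleftrightarrow> \<phi> ` P \<subseteq> Q \<and>
     (\<exists>T. simplicial_complex T \<and> \<Union>T = P \<and>
        (\<forall>S\<in>T. \<exists>h c. linear h \<and> (\<forall>x\<in>S. \<phi> x = h x + c)))"

definition pl_embedding ::
  "'a::euclidean_space set \<Rightarrow> 'b::euclidean_space set \<Rightarrow> ('a \<Rightarrow> 'b) \<Rightarrow> bool" where
  "pl_embedding P Q \<phi> \<longleftrightarrow> pl_map P Q \<phi> \<and> (\<exists>\<psi>. homeomorphism P (\<phi> ` P) \<phi> \<psi>)"

definition lifting :: "'a::euclidean_space set \<Rightarrow> 'b::euclidean_space set \<Rightarrow> ('a \<Rightarrow> 'b) \<Rightarrow>
    ('a \<Rightarrow> 'b \<times> real) \<Rightarrow> bool" where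
  "lifting P Q \<phi> g \<longleftrightarrow> pl_embedding P (Q \<times> UNIV) g \<and> (\<forall>x\<in>P. fst (g x) = \<phi> x)"

definition lifts_to_embedding ::
  "'a::euclidean_space set \<Rightarrow> 'b::euclidean_space set \<Rightarrow> ('a \<Rightarrow> 'b) \<Rightarrow> bool" where
  "lifts_to_embedding P Q \<phi> \<longleftrightarrow> (\<exists>g. lifting P Q \<phi> g)"

definition isotopic_liftings :: "'a::euclidean_space set \<Rightarrow> 'b::euclidean_space set \<Rightarrow>
    ('a \<Rightarrow> 'b) \<Rightarrow> ('a \<Rightarrow> 'b \<times> real) \<Rightarrow> ('a \<Rightarrow> 'b \<times> real) \<Rightarrow> bool" where
  "isotopic_liftings P Q \<phi> g g' \<longleftrightarrow>
     (\<exists>F :: 'a \<times> real \<Rightarrow> 'b \<times> real.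
        continuous_on (P \<times> {0..1}) F \<and>
        (\<forall>t\<in>{0..1}. lifting P Q \<phi> (\<lambda>x. F (x, t))) \<and>
        (\<forall>x\<in>P. F (x, 0) = g x) \<and> (\<forall>x\<in>P. F (x, 1) = g' x))"

text \<open>
  Liftings are total functions of which only the restriction to \<open>P\<close> matters; functions with the
  same restriction are isotopic by a constant isotopy, so they represent the same class.
\<close>

definition isotopy_classes :: "'a::euclidean_space set \<Rightarrow> 'b::euclidean_space set \<Rightarrow>
    ('a \<Rightarrow> 'b) \<Rightarrow> ('a \<Rightarrow> 'b \<times> real) set set" where
  "isotopy_classes P Q \<phi> =
     {g. lifting P Q \<phi> g} //
       {(g, g'). lifting P Q \<phi> g \<and> lifting P Q \<phi> g' \<and> isotopic_liftings P Q \<phi> g g'}"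

end

theory Submission
  imports Defs
begin

text \<open>
  A lifting of \<open>\<phi> = |f|\<close> is a pair of \<open>\<phi>\<close> and a piecewise linear height function that separates
  the points of every fibre of \<open>\<phi>\<close> (\<open>lifting_iff\<close>). Since \<open>f\<close> is nondegenerate, two distinct
  points of one fibre lie in distinct open simplices that \<open>f\<close> identifies vertex by vertex, and they
  have the same barycentric coordinates there (\<open>double_point_bijection\<close>). Moving both of them
  to a pair of distinct vertices with a common image shows that the sign of their height difference
  is the sign at those vertices (\<open>height_order_at_vertices\<close>). All comparisons that a lifting makes
  are therefore encoded in a finite datum, the order of the heights on each set of vertices with
  a common image.

  An isotopy cannot change this datum, and two liftings with the same datum are joined by a straight
  line of liftings, because convex combinations of numbers of equal strict sign are nonzero. So the
  isotopy classes correspond to the vertex orders that occur. This holds for \<open>K\<close> and, applied to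
  the restriction of \<open>f\<close>, for the 1-skeleton, which has the same vertices.

  It remains that the same orders occur for both (\<open>vertex_orders_skeleton_eq\<close>). Liftings restrict to
  the 1-skeleton. Conversely, a lifting over the 1-skeleton orders the endpoints of two edges with the
  same image consistently. Any two vertices of a simplex span an edge, so if two simplices have the
  same image, then all corresponding vertices that differ are ordered in the same way, and the linear
  extension of the vertex heights separates the fibres of \<open>\<phi>\<close> (\<open>is_lifting_of_vertex_heights\<close>).
\<close>

section \<open>Piecewise linear maps and liftings\<close>

text \<open>
  The pairwise intersections of the simplices form a cell complex of polytopes, and a cell complex
  has a simplicial subdivision.
\<close>
lemma simplicial_complex_common_refinement:
  assumes "simplicial_complex T" "simplicial_complex U"
  obtains W where "simplicial_complex W" "\<Union>W = \<Union>T \<inter> \<Union>U"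
    "\<And>S. S \<in> W \<Longrightarrow> \<exists>A\<in>T. \<exists>B\<in>U. S \<subseteq> A \<and> S \<subseteq> B"
proof -
  define M where "M = (\<lambda>(A, B). A \<inter> B) ` (T \<times> U)"
  have M: "C \<in> M \<longleftrightarrow> (\<exists>A\<in>T. \<exists>B\<in>U. C = A \<inter> B)" for C
    by (auto simp: M_def)
  have "finite M"
    using assms by (auto simp: M_def simplicial_complex_def)
  moreover have "polytope C" if "C \<in> M" for C
    using that assms unfolding M simplicial_complex_def
    by (metis polytope_Int simplex_imp_polytope)
  moreover have "C1 \<inter> C2 face_of C1" if C: "C1 \<in> M" "C2 \<in> M" for C1 C2
  proof -
    obtain A B A' B' where *: "A \<in> T" "B \<in> U" "A' \<in> T" "B' \<in> U" "C1 = A \<inter> B" "C2 = A' \<inter> B'"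
      using C unfolding M by blast
    have "A \<inter> A' face_of A" "B \<inter> B' face_of B"
      using * assms by (auto simp: simplicial_complex_def)
    then have "(A \<inter> A') \<inter> (B \<inter> B') face_of A \<inter> B"
      by (rule face_of_Int_Int)
    then show ?thesis
      using * by (simp add: Int_ac)
  qed
  ultimately have "\<exists>W. simplicial_complex W \<and> \<Union>W = \<Union>M \<and> (\<forall>S\<in>W. \<exists>C. C \<in> M \<and> S \<subseteq> C)"
    using simplicial_subdivision_of_cell_complex[of M] by metis
  then obtain W where W: "simplicial_complex W" "\<Union>W = \<Union>M"
      "\<And>S. S \<in> W \<Longrightarrow> \<exists>C. C \<in> M \<and> S \<subseteq> C"
    by blast
  have "\<Union>M = \<Union>T \<inter> \<Union>U"
    by (auto simp: M_def)
  moreover have "\<exists>A\<in>T. \<exists>B\<in>U. S \<subseteq> A \<and> S \<subseteq> B" if "S \<in> W" for S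
    using W(3)[OF that] unfolding M by blast
  ultimately show thesis
    using W that by metis
qed

lemma compact_simplicial_complex:
  assumes "simplicial_complex T"
  shows "compact (\<Union>T)"
  using assms unfolding simplicial_complex_def
  by (metis compact_Union compact_simplex)

lemma pl_map_compact: "pl_map P Q g \<Longrightarrow> compact P"
  unfolding pl_map_def using compact_simplicial_complex by blast

lemma pl_map_continuous_on:
  assumes "pl_map P Q g"
  shows "continuous_on P g"
proof -
  obtain T where T: "simplicial_complex T" "\<Union>T = P"
      "\<And>S. S \<in> T \<Longrightarrow> \<exists>h c. linear h \<and> (\<forall>x\<in>S. g x = h x + c)"
    using assms unfolding pl_map_def by blast
  have "continuous_on (\<Union>S\<in>T. S) g"
  proof (rule continuous_on_closed_Union)
    show "finite T" using T(1) by (simp add: simplicial_complex_def)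
    show "closed S" if "S \<in> T" for S
      using that T(1) closed_simplex unfolding simplicial_complex_def by blast
    show "continuous_on S g" if S: "S \<in> T" for S
    proof -
      obtain h c where "linear h" "\<forall>x\<in>S. g x = h x + c" using T(3)[OF S] by blast
      then show ?thesis
        by (subst continuous_on_cong[OF refl, where g = "\<lambda>x. h x + c"])
           (simp_all add: continuous_on_add linear_continuous_on linear_conv_bounded_linear)
    qed
  qed
  then show ?thesis using T(2) by simp
qed

lemma pl_map_iff_UNIV: "pl_map P Q g \<longleftrightarrow> g ` P \<subseteq> Q \<and> pl_map P UNIV g"
  by (auto simp: pl_map_def)

lemma pl_map_subset:
  assumes g: "pl_map P UNIV g" and M: "simplicial_complex M" "\<Union>M \<subseteq> P"
  shows "pl_map (\<Union>M) UNIV g"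
proof -
  obtain T where T: "simplicial_complex T" "\<Union>T = P"
      "\<And>S. S \<in> T \<Longrightarrow> \<exists>h c. linear h \<and> (\<forall>x\<in>S. g x = h x + c)"
    using g unfolding pl_map_def by blast
  obtain W where W: "simplicial_complex W" "\<Union>W = \<Union>T \<inter> \<Union>M"
      "\<And>S. S \<in> W \<Longrightarrow> \<exists>A\<in>T. \<exists>B\<in>M. S \<subseteq> A \<and> S \<subseteq> B"
    using simplicial_complex_common_refinement[OF T(1) M(1)] by metis
  have "\<exists>h c. linear h \<and> (\<forall>x\<in>S. g x = h x + c)" if S: "S \<in> W" for S
    using W(3)[OF S] T(3) by (metis subsetD)
  then show ?thesis
    unfolding pl_map_def using W(1,2) T(2) M(2) by (intro conjI exI[of _ W]) auto
qed

text \<open>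
  This makes the straight line between two liftings consist of piecewise linear maps. The two maps
  may be affine on the simplices of different triangulations, so a common refinement is taken.
\<close>
lemma pl_map_linear_combination:
  assumes f: "pl_map P UNIV f" and g: "pl_map P UNIV g"
  shows "pl_map P UNIV (\<lambda>x. a *\<^sub>R f x + b *\<^sub>R g x)"
proof -
  obtain T where T: "simplicial_complex T" "\<Union>T = P"
      "\<And>S. S \<in> T \<Longrightarrow> \<exists>h c. linear h \<and> (\<forall>x\<in>S. f x = h x + c)"
    using f unfolding pl_map_def by blast
  obtain U where U: "simplicial_complex U" "\<Union>U = P"
      "\<And>S. S \<in> U \<Longrightarrow> \<exists>h c. linear h \<and> (\<forall>x\<in>S. g x = h x + c)"
    using g unfolding pl_map_def by blast
  obtain W where W: "simplicial_complex W" "\<Union>W = \<Union>T \<inter> \<Union>U"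
      "\<And>S. S \<in> W \<Longrightarrow> \<exists>A\<in>T. \<exists>B\<in>U. S \<subseteq> A \<and> S \<subseteq> B"
    using simplicial_complex_common_refinement[OF T(1) U(1)] by metis
  have "\<exists>h c. linear h \<and> (\<forall>x\<in>S. a *\<^sub>R f x + b *\<^sub>R g x = h x + c)" if S: "S \<in> W" for S
  proof -
    obtain A B where "A \<in> T" "B \<in> U" "S \<subseteq> A" "S \<subseteq> B"
      using W(3)[OF S] by blast
    then obtain h c k d where *: "linear h" "\<forall>x\<in>S. f x = h x + c" "linear k" "\<forall>x\<in>S. g x = k x + d"
      using T(3) U(3) by (metis subsetD)
    have "linear (\<lambda>x. a *\<^sub>R h x + b *\<^sub>R k x)"
      using *(1,3) by (intro linear_compose_add linear_compose_scale_right)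
    moreover have "\<forall>x\<in>S. a *\<^sub>R f x + b *\<^sub>R g x = (a *\<^sub>R h x + b *\<^sub>R k x) + (a *\<^sub>R c + b *\<^sub>R d)"
      using *(2,4) by (simp add: algebra_simps)
    ultimately show ?thesis by blast
  qed
  then show ?thesis
    unfolding pl_map_def using W(1,2) T(2) U(2) by (intro conjI exI[of _ W]) auto
qed

text \<open>
  Since \<open>P\<close> is compact, the homeomorphism condition on an embedding is only injectivity. A map
  over \<open>\<phi>\<close> is injective if its height \<open>snd \<circ> g\<close> separates the points of each fibre of \<open>\<phi>\<close>.
\<close>
lemma lifting_iff:
  assumes "\<phi> ` P \<subseteq> Q"
  shows "lifting P Q \<phi> g \<longleftrightarrow> pl_map P UNIV g \<and> (\<forall>x\<in>P. fst (g x) = \<phi> x) \<and>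
    (\<forall>x\<in>P. \<forall>y\<in>P. x \<noteq> y \<longrightarrow> \<phi> x = \<phi> y \<longrightarrow> snd (g x) \<noteq> snd (g y))"
    (is "?L \<longleftrightarrow> ?R")
proof
  assume L: ?L
  then obtain \<psi> where "homeomorphism P (g ` P) g \<psi>"
    by (auto simp: lifting_def pl_embedding_def)
  then have inj: "inj_on g P"
    by (metis homeomorphism_apply1 inj_on_inverseI)
  have fst: "\<forall>x\<in>P. fst (g x) = \<phi> x"
    using L by (simp add: lifting_def)
  have "pl_map P UNIV g"
    using L by (auto simp: lifting_def pl_embedding_def pl_map_iff_UNIV[of P "Q \<times> UNIV"])
  moreover have "snd (g x) \<noteq> snd (g y)" if "x \<in> P" "y \<in> P" "x \<noteq> y" "\<phi> x = \<phi> y" for x y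
    using that inj fst by (metis inj_onD prod_eqI)
  ultimately show ?R using fst by blast
next
  assume R: ?R
  have inj: "inj_on g P"
  proof (rule inj_onI)
    fix x y assume xy: "x \<in> P" "y \<in> P" "g x = g y"
    then have "\<phi> x = \<phi> y" using R by metis
    then show "x = y" using R xy by metis
  qed
  have "g ` P \<subseteq> Q \<times> UNIV"
  proof
    fix z assume "z \<in> g ` P"
    then obtain x where "x \<in> P" "z = g x" by blast
    then show "z \<in> Q \<times> UNIV" using R assms by (auto simp: mem_Times_iff)
  qed
  moreover have "\<exists>\<psi>. homeomorphism P (g ` P) g \<psi>"
    using R inj by (intro homeomorphism_compact pl_map_compact[of P UNIV] pl_map_continuous_on[of P UNIV]) auto
  ultimately show ?L
    using R by (simp add: lifting_def pl_embedding_def pl_map_iff_UNIV[of P "Q \<times> UNIV"])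
qed

section \<open>Barycentric coordinates and realizations\<close>

lemma vertex_setsD:
  assumes "C \<in> vertex_sets K"
  shows "finite C" "\<not> affine_dependent C" "convex hull C \<in> K"
  using assms by (auto simp: vertex_sets_def)

lemma simplex_vertex_set:
  assumes "simplicial_complex K" "S \<in> K"
  obtains C where "C \<in> vertex_sets K" "S = convex hull C"
proof -
  obtain n where "n simplex S"
    using assms by (auto simp: simplicial_complex_def)
  then show thesis
    using that assms(2) by (auto simp: simplex vertex_sets_def)
qed

lemma vertex_sets_subset:
  assumes "simplicial_complex K" "C \<in> vertex_sets K" "D \<subseteq> C"
  shows "D \<in> vertex_sets K"
proof -
  have C: "\<not> affine_dependent C" "finite C" "convex hull C \<in> K"
    using vertex_setsD[OF assms(2)] by auto
  have "convex hull D face_of convex hull C"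
    using assms(3) face_of_convex_hull_affine_independent[OF C(1)] by blast
  then have "convex hull D \<in> K"
    using assms(1) C(3) unfolding simplicial_complex_def by blast
  then show ?thesis
    using C assms(3) affine_independent_subset finite_subset by (auto simp: vertex_sets_def)
qed

text \<open>
  The open simplices of a complex are disjoint: the intersection of two simplices is a face of both,
  and a face that meets the relative interior is the whole simplex; a simplex in turn determines its
  vertices, which are its extreme points.
\<close>
lemma vertex_sets_rel_interior_eq:
  assumes K: "simplicial_complex K" and C: "C \<in> vertex_sets K" and D: "D \<in> vertex_sets K"
    and x: "x \<in> rel_interior (convex hull C)" "x \<in> rel_interior (convex hull D)"
  shows "C = D"
proof -
  have 1: "convex hull C \<inter> convex hull D face_of convex hull C"
          "convex hull D \<inter> convex hull C face_of convex hull D"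
    using K vertex_setsD(3)[OF C] vertex_setsD(3)[OF D] by (auto simp: simplicial_complex_def)
  have xx: "x \<in> convex hull C" "x \<in> convex hull D"
    using x rel_interior_subset by blast+
  have "convex hull C \<inter> convex hull D = convex hull C"
    using face_of_disjoint_rel_interior[OF 1(1)] x xx by blast
  moreover have "convex hull D \<inter> convex hull C = convex hull D"
    using face_of_disjoint_rel_interior[OF 1(2)] x xx by blast
  ultimately have "convex hull C = convex hull D" by blast
  then show ?thesis
    using extreme_point_of_convex_hull_affine_independent vertex_setsD(2)[OF C] vertex_setsD(2)[OF D]
    by (metis set_eqI)
qed

lemma positive_combination_in_rel_interior:
  assumes "C \<in> vertex_sets K" "\<And>v. v \<in> C \<Longrightarrow> 0 < u v" "sum u C = 1"
  shows "(\<Sum>v\<in>C. u v *\<^sub>R v) \<in> rel_interior (convex hull C)"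
  unfolding rel_interior_convex_hull_explicit[OF vertex_setsD(2)[OF assms(1)]]
  using assms(2,3) by blast

lemma mem_rel_interior_of_coords:
  assumes "C \<in> vertex_sets K" "\<forall>v\<in>C. 0 \<le> u v" "sum u C = 1" "simplicial_complex K"
  shows "(\<Sum>v\<in>C. u v *\<^sub>R v) \<in> rel_interior (convex hull {v\<in>C. 0 < u v})"
    and "{v\<in>C. 0 < u v} \<in> vertex_sets K"
proof -
  let ?C = "{v\<in>C. 0 < u v}"
  show C: "?C \<in> vertex_sets K"
    by (rule vertex_sets_subset[OF assms(4,1)]) auto
  have z: "\<forall>v\<in>C - ?C. u v = 0"
    using assms(2) by force
  have "sum u ?C = sum u C"
    by (rule sum.mono_neutral_left[OF vertex_setsD(1)[OF assms(1)] _ z]) blast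
  moreover have "(\<Sum>v\<in>?C. u v *\<^sub>R v) = (\<Sum>v\<in>C. u v *\<^sub>R v)"
    by (rule sum.mono_neutral_left[OF vertex_setsD(1)[OF assms(1)]]) (use z in \<open>blast, metis scaleR_zero_left\<close>)
  ultimately show "(\<Sum>v\<in>C. u v *\<^sub>R v) \<in> rel_interior (convex hull ?C)"
    using assms(3) unfolding rel_interior_convex_hull_explicit[OF vertex_setsD(2)[OF C]]
    by auto
qed

lemma affine_independent_coords_unique:
  fixes u w :: "'a::real_vector \<Rightarrow> real"
  assumes "finite C" "\<not> affine_dependent C" "sum u C = sum w C"
    "(\<Sum>v\<in>C. u v *\<^sub>R v) = (\<Sum>v\<in>C. w v *\<^sub>R v)" "v \<in> C"
  shows "u v = w v"
proof (rule ccontr)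
  assume "u v \<noteq> w v"
  then have "sum (\<lambda>v. u v - w v) C = 0 \<and> (\<exists>v\<in>C. u v - w v \<noteq> 0) \<and>
      (\<Sum>v\<in>C. (u v - w v) *\<^sub>R v) = 0"
    using assms by (auto simp: sum_subtractf scaleR_diff_left)
  then show False
    using assms(1,2) affine_dependent_explicit_finite by blast
qed

text \<open>
  The vertices with positive coordinate span the open simplex that contains the point, so two
  coordinate functions have the same support, and on the support they agree by affine independence.
\<close>
lemma barycentric_coords_unique:
  assumes K: "simplicial_complex K" and u: "barycentric_coords K x u" and w: "barycentric_coords K x w"
  shows "u = w"
proof -
  obtain C where C: "C \<in> vertex_sets K" "\<forall>v. v \<notin> C \<longrightarrow> u v = 0" "\<forall>v\<in>C. 0 \<le> u v" "sum u C = 1"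
      "(\<Sum>v\<in>C. u v *\<^sub>R v) = x"
    using u by (auto simp: barycentric_coords_def)
  obtain D where D: "D \<in> vertex_sets K" "\<forall>v. v \<notin> D \<longrightarrow> w v = 0" "\<forall>v\<in>D. 0 \<le> w v" "sum w D = 1"
      "(\<Sum>v\<in>D. w v *\<^sub>R v) = x"
    using w by (auto simp: barycentric_coords_def)
  have fin: "finite C" "finite D" using C(1) D(1) by (auto dest: vertex_setsD)
  define E where "E = {v\<in>C. 0 < u v}"
  note riC = mem_rel_interior_of_coords[OF C(1,3,4) K]
  note riD = mem_rel_interior_of_coords[OF D(1,3,4) K]
  have "{v\<in>C. 0 < u v} = {v\<in>D. 0 < w v}"
    by (rule vertex_sets_rel_interior_eq[OF K riC(2) riD(2), of x])
       (use riC(1) riD(1) C(5) D(5) in simp_all)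
  then have E': "E = {v\<in>D. 0 < w v}" by (simp add: E_def)
  have 0: "u v = 0" "w v = 0" if "v \<notin> E" for v
    using that C(2,3) D(2,3) unfolding E_def by (smt (verit) E' E_def mem_Collect_eq)+
  have sub: "E \<subseteq> C" "E \<subseteq> D" using E_def E' by auto
  have s: "sum u E = sum u C" "sum w E = sum w D"
       "(\<Sum>v\<in>E. u v *\<^sub>R v) = (\<Sum>v\<in>C. u v *\<^sub>R v)" "(\<Sum>v\<in>E. w v *\<^sub>R v) = (\<Sum>v\<in>D. w v *\<^sub>R v)"
    by (rule sum.mono_neutral_left; use fin sub 0 in simp)+
  have E: "finite E" "\<not> affine_dependent E"
    using vertex_setsD[OF mem_rel_interior_of_coords(2)[OF C(1,3,4) K]] E_def by auto
  have "u v = w v" for v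
  proof (cases "v \<in> E")
    case True
    show ?thesis
      by (rule affine_independent_coords_unique[OF E _ _ True]) (simp_all only: s C(4,5) D(4,5))
  next
    case False
    then show ?thesis using 0 by metis
  qed
  then show ?thesis by blast
qed

lemma vertex_sets_subset_complex_vertices:
  assumes "simplicial_complex K" "C \<in> vertex_sets K"
  shows "C \<subseteq> complex_vertices K"
proof
  fix v assume "v \<in> C"
  then have "{v} \<in> vertex_sets K"
    by (intro vertex_sets_subset[OF assms]) simp
  then show "v \<in> complex_vertices K"
    using vertex_setsD(3) by (fastforce simp: complex_vertices_def)
qed

lemma finite_complex_vertices:
  assumes "simplicial_complex K"
  shows "finite (complex_vertices K)"
proof -
  have "finite ((\<lambda>v. {v}) ` complex_vertices K)"
    using assms by (rule_tac finite_subset[of _ K]) (auto simp: complex_vertices_def simplicial_complex_def)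
  then show ?thesis
    by (rule finite_imageD) (auto simp: inj_on_def)
qed

lemma realization_convex_combination:
  assumes K: "simplicial_complex K" and C: "C \<in> vertex_sets K" and u: "\<forall>v\<in>C. 0 \<le> u v" "sum u C = 1"
  shows "realization K f (\<Sum>v\<in>C. u v *\<^sub>R v) = (\<Sum>v\<in>C. u v *\<^sub>R f v)"
proof -
  define w where "w v = (if v \<in> C then u v else 0)" for v
  have "barycentric_coords K (\<Sum>v\<in>C. u v *\<^sub>R v) w"
    unfolding barycentric_coords_def using C u by (intro bexI[of _ C]) (auto simp: w_def)
  then have w: "(THE u'. barycentric_coords K (\<Sum>v\<in>C. u v *\<^sub>R v) u') = w"
    using barycentric_coords_unique[OF K] by blast
  have "(\<Sum>v\<in>complex_vertices K. w v *\<^sub>R f v) = (\<Sum>v\<in>C. w v *\<^sub>R f v)"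
    using vertex_sets_subset_complex_vertices[OF K C] finite_complex_vertices[OF K]
    by (intro sum.mono_neutral_right) (auto simp: w_def)
  then show ?thesis
    unfolding realization_def w by (simp add: w_def)
qed

lemma realization_vertex:
  assumes "simplicial_complex K" "v \<in> complex_vertices K"
  shows "realization K f v = f v"
proof -
  have "{v} \<in> vertex_sets K"
    using assms(2) by (auto simp: vertex_sets_def complex_vertices_def)
  from realization_convex_combination[OF assms(1) this, of "\<lambda>_. 1" f] show ?thesis by simp
qed

text \<open>
  After translation by one of the points the others become linearly independent, so a linear map
  can be prescribed on them.
\<close>
lemma affine_extension:
  fixes f :: "'a::euclidean_space \<Rightarrow> 'b::euclidean_space"
  assumes "\<not> affine_dependent C"
  obtains h c where "linear h" "\<And>v. v \<in> C \<Longrightarrow> f v = h v + c"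
proof (cases "C = {}")
  case True
  then show thesis using that[of "\<lambda>_. 0"] by (auto simp: linear_zero)
next
  case False
  then obtain a where a: "a \<in> C" by blast
  have "independent ((\<lambda>x. -a + x) ` (C - {a}))"
    using assms affine_dependent_iff_dependent2[OF a] by simp
  from linear_independent_extend[OF this, of "\<lambda>x. f (a + x) - f a"]
  obtain h where h: "linear h" "\<forall>x\<in>(\<lambda>x. -a + x) ` (C - {a}). h x = f (a + x) - f a"
    by blast
  have "f v = h v + (f a - h a)" if "v \<in> C" for v
  proof (cases "v = a")
    case False
    then have "h (-a + v) = f v - f a" using that h(2) by auto
    moreover have "h (-a + v) = h v - h a"
      using linear_diff[OF h(1), of v a] by simp
    ultimately have "f v - f a = h v - h a" by simp
    then have "f v = h v - h a + f a" by (simp add: diff_eq_eq)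
    then show ?thesis by (simp add: algebra_simps)
  qed simp
  then show thesis using that h(1) by blast
qed

lemma realization_affine:
  assumes K: "simplicial_complex K" and C: "C \<in> vertex_sets K"
  obtains h c where "linear h" "\<And>x. x \<in> convex hull C \<Longrightarrow> realization K f x = h x + c"
proof -
  obtain h c where h: "linear h" "\<And>v. v \<in> C \<Longrightarrow> f v = h v + c"
    using affine_extension[OF vertex_setsD(2)[OF C]] by metis
  have "realization K f x = h x + c" if x: "x \<in> convex hull C" for x
  proof -
    obtain u where u: "\<forall>v\<in>C. 0 \<le> u v" "sum u C = 1" "(\<Sum>v\<in>C. u v *\<^sub>R v) = x"
      using x vertex_setsD(1)[OF C] by (auto simp: convex_hull_finite)
    have "realization K f x = (\<Sum>v\<in>C. u v *\<^sub>R f v)"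
      using realization_convex_combination[OF K C u(1,2)] u(3) by simp
    also have "\<dots> = (\<Sum>v\<in>C. u v *\<^sub>R h v) + (\<Sum>v\<in>C. u v) *\<^sub>R c"
      by (simp add: h(2) scaleR_add_right sum.distrib scaleR_sum_left)
    also have "\<dots> = h x + c"
      using h(1) u(2) by (simp add: u(3)[symmetric] linear_sum linear_scale)
    finally show ?thesis .
  qed
  then show thesis using that h(1) by blast
qed

lemma pl_map_realization:
  assumes "simplicial_complex K"
  shows "pl_map (\<Union>K) UNIV (realization K f)"
  unfolding pl_map_def
proof (intro conjI exI[of _ K] ballI)
  fix S assume "S \<in> K"
  then obtain C where "C \<in> vertex_sets K" "S = convex hull C"
    using simplex_vertex_set assms by blast
  then show "\<exists>h c. linear h \<and> (\<forall>x\<in>S. realization K f x = h x + c)"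
    using realization_affine[OF assms] by metis
qed (use assms in auto)

text \<open>
  Dropping the vertices with coordinate zero passes to the face whose open simplex contains the point.
\<close>
lemma carrier_exists:
  assumes K: "simplicial_complex K" and "x \<in> \<Union>K"
  obtains C u where "C \<in> vertex_sets K" "\<And>v. v \<in> C \<Longrightarrow> 0 < u v" "sum u C = 1"
    "(\<Sum>v\<in>C. u v *\<^sub>R v) = x"
proof -
  obtain S where "S \<in> K" "x \<in> S" using assms by blast
  then obtain D where D: "D \<in> vertex_sets K" "x \<in> convex hull D"
    using simplex_vertex_set[OF K] by metis
  obtain w where w: "\<forall>v\<in>D. 0 \<le> w v" "sum w D = 1" "(\<Sum>v\<in>D. w v *\<^sub>R v) = x"
    using D(2) vertex_setsD(1)[OF D(1)] by (auto simp: convex_hull_finite)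
  note m = mem_rel_interior_of_coords[OF D(1) w(1,2) K]
  show thesis
    using that[OF m(2)] m(1) rel_interior_convex_hull_explicit[OF vertex_setsD(2)[OF m(2)]] w(3)
    by auto
qed

lemma realization_subcomplex:
  assumes "simplicial_complex K" "simplicial_complex M" "M \<subseteq> K" "x \<in> \<Union>M"
  shows "realization M f x = realization K f x"
proof -
  obtain C u where C: "C \<in> vertex_sets M" "\<And>v. v \<in> C \<Longrightarrow> 0 < u v" "sum u C = 1"
      "(\<Sum>v\<in>C. u v *\<^sub>R v) = x"
    using carrier_exists[OF assms(2,4)] by metis
  have "C \<in> vertex_sets K" using C(1) assms(3) by (auto simp: vertex_sets_def)
  then show ?thesis
    using realization_convex_combination[of K C u f] realization_convex_combination[of M C u f] C assms
    by (auto simp: less_imp_le)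
qed

section \<open>Double points of a nondegenerate simplicial map\<close>

lemma continuous_nonzero_same_sign:
  fixes d :: "real \<Rightarrow> real"
  assumes d: "continuous_on {0..1} d" and nz: "\<And>s. s \<in> {0..1} \<Longrightarrow> d s \<noteq> 0"
  shows "d 0 < 0 \<longleftrightarrow> d 1 < 0"
proof (rule ccontr)
  assume "(d 0 < 0) \<noteq> (d 1 < 0)"
  then consider "d 0 \<le> 0" "0 \<le> d 1" | "d 1 \<le> 0" "0 \<le> d 0" by linarith
  then have "\<exists>s. 0 \<le> s \<and> s \<le> 1 \<and> d s = 0"
  proof cases
    case 1
    then show ?thesis using IVT'[of d 0 0 1] d by auto
  next
    case 2
    then show ?thesis using IVT2'[of d 1 0 0] d by auto
  qed
  then show False using nz by auto
qed

lemma bij_betw_quotient_kernel: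
  "bij_betw (\<lambda>c. {x\<in>A. k x = c}) (k ` A) (A // {(x, y). x \<in> A \<and> y \<in> A \<and> k x = k y})"
proof (rule bij_betw_imageI)
  show "inj_on (\<lambda>c. {x\<in>A. k x = c}) (k ` A)"
    by (auto simp: inj_on_def)
  have "{(x, y). x \<in> A \<and> y \<in> A \<and> k x = k y} `` {a} = {x\<in>A. k x = k a}" if "a \<in> A" for a
    using that by auto
  then show "(\<lambda>c. {x\<in>A. k x = c}) ` k ` A = A // {(x, y). x \<in> A \<and> y \<in> A \<and> k x = k y}"
    by (simp add: quotient_def image_image UNION_singleton_eq_range)
qed

text \<open>
  The order of heights on each set of vertices with a common image. It is the complete isotopy
  invariant of liftings, and it is the same datum for a complex and for its 1-skeleton.
\<close>
definition vertex_order ::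
  "'a::euclidean_space set set \<Rightarrow> ('a \<Rightarrow> 'b) \<Rightarrow> ('a \<Rightarrow> 'b \<times> real) \<Rightarrow> ('a \<times> 'a) set" where
  "vertex_order K f g =
     {(v, v'). v \<in> complex_vertices K \<and> v' \<in> complex_vertices K \<and> f v = f v' \<and> snd (g v) < snd (g v')}"

locale nondegenerate_simplicial_map =
  fixes K :: "'a::euclidean_space set set"
    and L :: "'b::euclidean_space set set"
    and f :: "'a \<Rightarrow> 'b"
  assumes complex_K: "simplicial_complex K"
    and complex_L: "simplicial_complex L"
    and simplicial: "simplicial_map K L f"
    and nondegenerate: "nondegenerate K f"
begin

abbreviation \<phi> :: "'a \<Rightarrow> 'b" where "\<phi> \<equiv> realization K f"

abbreviation is_lifting :: "('a \<Rightarrow> 'b \<times> real) \<Rightarrow> bool" where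
  "is_lifting \<equiv> lifting (\<Union>K) (\<Union>L) \<phi>"

lemma image_vertex_set: "C \<in> vertex_sets K \<Longrightarrow> f ` C \<in> vertex_sets L"
  using simplicial by (simp add: simplicial_map_def)

lemma inj_on_vertex_set: "C \<in> vertex_sets K \<Longrightarrow> inj_on f C"
  using nondegenerate by (simp add: nondegenerate_def)

lemma complex_verticesD:
  assumes "v \<in> complex_vertices K"
  shows "{v} \<in> vertex_sets K" "v \<in> \<Union>K" "\<phi> v = f v"
  using assms realization_vertex[OF complex_K assms] by (auto simp: complex_vertices_def vertex_sets_def)

lemma realization_subset: "\<phi> ` \<Union>K \<subseteq> \<Union>L"
proof (rule image_subsetI)
  fix x assume "x \<in> \<Union>K"
  then obtain C u where C: "C \<in> vertex_sets K" "\<And>v. v \<in> C \<Longrightarrow> 0 < u v" "sum u C = 1"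
      "(\<Sum>v\<in>C. u v *\<^sub>R v) = x"
    using carrier_exists[OF complex_K] by metis
  have "\<phi> x = (\<Sum>v\<in>C. u v *\<^sub>R f v)"
    using realization_convex_combination[OF complex_K C(1) _ C(3)] C(2,4) by (auto simp: less_imp_le)
  also have "\<dots> \<in> convex hull (f ` C)"
    using C by (intro convex_sum vertex_setsD(1)[OF C(1)]) (auto simp: hull_inc less_imp_le)
  finally show "\<phi> x \<in> \<Union>L"
    using vertex_setsD(3)[OF image_vertex_set[OF C(1)]] by blast
qed

lemmas is_lifting_iff = lifting_iff[OF realization_subset]

text \<open>
  By nondegeneracy, pushing the coordinates of a point forward along \<open>f\<close> gives positive coordinates
  of its image with respect to the vertex set \<open>f ` C\<close>. As the coordinates of the common image are
  unique, \<open>f ` C = f ` D\<close>, and matching vertices with the same image also matches coordinates.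
\<close>
lemma same_image_bijection:
  assumes C: "C \<in> vertex_sets K" "\<And>v. v \<in> C \<Longrightarrow> 0 < u v" "sum u C = 1"
    and D: "D \<in> vertex_sets K" "\<And>v. v \<in> D \<Longrightarrow> 0 < w v" "sum w D = 1"
    and eq: "\<phi> (\<Sum>v\<in>C. u v *\<^sub>R v) = \<phi> (\<Sum>v\<in>D. w v *\<^sub>R v)"
  obtains p where "bij_betw p C D" "\<And>v. v \<in> C \<Longrightarrow> f (p v) = f v" "\<And>v. v \<in> C \<Longrightarrow> w (p v) = u v"
proof -
  \<comment> \<open>Coordinates of the common image in \<open>L\<close>, obtained from those of the two points.\<close>
  define u' where "u' q = u (inv_into C f q)" for q
  define w' where "w' q = w (inv_into D f q)" for q
  note inj = inj_on_vertex_set[OF C(1)] inj_on_vertex_set[OF D(1)]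
  note vs = image_vertex_set[OF C(1)] image_vertex_set[OF D(1)]
  have u': "u' (f v) = u v" if "v \<in> C" for v using that inj(1) by (simp add: u'_def)
  have w': "w' (f v) = w v" if "v \<in> D" for v using that inj(2) by (simp add: w'_def)
  have su: "sum u' (f ` C) = 1"
    using C(3) u' by (simp add: sum.reindex[OF inj(1)])
  have sw: "sum w' (f ` D) = 1"
    using D(3) w' by (simp add: sum.reindex[OF inj(2)])
  have pu: "\<phi> (\<Sum>v\<in>C. u v *\<^sub>R v) = (\<Sum>q\<in>f ` C. u' q *\<^sub>R q)"
    using realization_convex_combination[OF complex_K C(1) _ C(3)] C(2) u'
    by (simp add: sum.reindex[OF inj(1)] less_imp_le)
  have pw: "\<phi> (\<Sum>v\<in>D. w v *\<^sub>R v) = (\<Sum>q\<in>f ` D. w' q *\<^sub>R q)"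
    using realization_convex_combination[OF complex_K D(1) _ D(3)] D(2) w'
    by (simp add: sum.reindex[OF inj(2)] less_imp_le)
  have img: "f ` C = f ` D"
  proof (rule vertex_sets_rel_interior_eq[OF complex_L vs])
    show "\<phi> (\<Sum>v\<in>C. u v *\<^sub>R v) \<in> rel_interior (convex hull (f ` C))"
      unfolding pu by (rule positive_combination_in_rel_interior[OF vs(1) _ su]) (use u' C(2) in auto)
    show "\<phi> (\<Sum>v\<in>C. u v *\<^sub>R v) \<in> rel_interior (convex hull (f ` D))"
      unfolding eq pw by (rule positive_combination_in_rel_interior[OF vs(2) _ sw]) (use w' D(2) in auto)
  qed
  have coords: "u' q = w' q" if "q \<in> f ` C" for q
    using affine_independent_coords_unique[OF vertex_setsD(1,2)[OF vs(1)], of u' w' q]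
      that su sw pu pw eq img by simp
  define p where "p v = inv_into D f (f v)" for v
  have p: "p v \<in> D" "f (p v) = f v" if "v \<in> C" for v
    unfolding p_def using that img imageI[OF that, of f] by (simp_all add: inv_into_into f_inv_into_f)
  have "bij_betw (inv_into D f \<circ> f) C D"
    using inj img by (intro bij_betw_trans[OF inj_on_imp_bij_betw] bij_betw_inv_into) (auto simp: bij_betw_def)
  then have "bij_betw p C D"
    by (simp add: p_def[abs_def] comp_def)
  moreover have "w (p v) = u v" if "v \<in> C" for v
    using coords[of "f v"] u'[OF that] w'[OF p(1)[OF that]] p(2)[OF that] that by simp
  ultimately show thesis using that p(2) by blast
qed

text \<open>
  Both points are written with the same coordinates, so that any map affine on simplices differs at
  them by a weighted sum of its differences at the vertex pairs \<open>(v, p v)\<close>. The pairs cannot all be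
  trivial, since otherwise \<open>x = y\<close>.
\<close>
lemma double_point_bijection:
  assumes "x \<in> \<Union>K" "y \<in> \<Union>K" "x \<noteq> y" "\<phi> x = \<phi> y"
  obtains C p u where "C \<in> vertex_sets K" "p ` C \<in> vertex_sets K" "inj_on p C"
    "\<forall>v\<in>C. f (p v) = f v" "\<forall>v\<in>C. 0 < u v" "sum u C = 1"
    "x = (\<Sum>v\<in>C. u v *\<^sub>R v)" "y = (\<Sum>v\<in>C. u v *\<^sub>R p v)" "\<exists>v\<in>C. p v \<noteq> v"
proof -
  obtain C u where C: "C \<in> vertex_sets K" "\<And>v. v \<in> C \<Longrightarrow> 0 < u v" "sum u C = 1"
      "(\<Sum>v\<in>C. u v *\<^sub>R v) = x"
    using carrier_exists[OF complex_K assms(1)] by metis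
  obtain D w where D: "D \<in> vertex_sets K" "\<And>v. v \<in> D \<Longrightarrow> 0 < w v" "sum w D = 1"
      "(\<Sum>v\<in>D. w v *\<^sub>R v) = y"
    using carrier_exists[OF complex_K assms(2)] by metis
  have "\<phi> (\<Sum>v\<in>C. u v *\<^sub>R v) = \<phi> (\<Sum>v\<in>D. w v *\<^sub>R v)"
    using C(4) D(4) assms(4) by simp
  then obtain p where p: "bij_betw p C D" "\<And>v. v \<in> C \<Longrightarrow> f (p v) = f v" "\<And>v. v \<in> C \<Longrightarrow> w (p v) = u v"
    using same_image_bijection[OF C(1-3) D(1-3)] by metis
  have y: "y = (\<Sum>v\<in>C. u v *\<^sub>R p v)"
    unfolding D(4)[symmetric] sum.reindex_bij_betw[OF p(1), symmetric] using p(3) by simp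
  have "\<exists>v\<in>C. p v \<noteq> v"
    using assms(3) y C(4) by (metis (no_types, lifting) sum.cong)
  then show thesis
    using that[OF C(1) _ _ _ _ C(3) C(4)[symmetric] y] p(1,2) C(2) D(1) by (simp add: bij_betw_def)
qed

section \<open>Isotopy classes and vertex orders\<close>

text \<open>
  The two points are moved simultaneously along segments to vertices with a common image. They stay
  in one fibre, and they stay distinct because until the end they lie in different open simplices.
  The difference of their heights is continuous and never zero, so its sign at the start is the
  sign at the end.
\<close>
lemma height_order_at_vertices:
  assumes g: "is_lifting g"
    and C: "C \<in> vertex_sets K" "x \<in> rel_interior (convex hull C)" "v \<in> C"
    and D: "D \<in> vertex_sets K" "y \<in> rel_interior (convex hull D)" "v' \<in> D"
    and eq: "\<phi> x = \<phi> y" "f v = f v'" "v \<noteq> v'"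
  shows "snd (g x) < snd (g y) \<longleftrightarrow> snd (g v) < snd (g v')"
proof -
  have "C \<noteq> D"
    using eq(2,3) C(3) D(3) inj_on_vertex_set[OF C(1)] by (metis inj_onD)
  note hull = vertex_setsD(3)[OF C(1)] vertex_setsD(3)[OF D(1)]
  define X where "X s = (1 - s) *\<^sub>R x + s *\<^sub>R v" for s :: real
  define Y where "Y s = (1 - s) *\<^sub>R y + s *\<^sub>R v'" for s :: real
  have x: "x \<in> convex hull C" "v \<in> convex hull C"
    using subsetD[OF rel_interior_subset C(2)] hull_inc[OF C(3)] by auto
  have y: "y \<in> convex hull D" "v' \<in> convex hull D"
    using subsetD[OF rel_interior_subset D(2)] hull_inc[OF D(3)] by auto
  have vert: "v \<in> complex_vertices K" "v' \<in> complex_vertices K"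
    using vertex_sets_subset_complex_vertices[OF complex_K] C D by blast+
  have XK: "X s \<in> convex hull C" and YK: "Y s \<in> convex hull D" if "s \<in> {0..1}" for s
    using that x y by (auto simp: X_def Y_def intro!: convexD[OF convex_convex_hull])
  have \<phi>X: "\<phi> (X s) = (1 - s) *\<^sub>R \<phi> x + s *\<^sub>R \<phi> v" if "s \<in> {0..1}" for s
  proof -
    obtain h c where h: "linear h" "\<And>z. z \<in> convex hull C \<Longrightarrow> \<phi> z = h z + c"
      using realization_affine[OF complex_K C(1)] by metis
    have "h (X s) = (1 - s) *\<^sub>R h x + s *\<^sub>R h v"
      unfolding X_def by (simp only: linear_add[OF h(1)] linear_scale[OF h(1)])
    then show ?thesis
      unfolding h(2)[OF XK[OF that]] h(2)[OF x(1)] h(2)[OF x(2)]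
      by (simp add: algebra_simps)
  qed
  have \<phi>Y: "\<phi> (Y s) = (1 - s) *\<^sub>R \<phi> y + s *\<^sub>R \<phi> v'" if "s \<in> {0..1}" for s
  proof -
    obtain h c where h: "linear h" "\<And>z. z \<in> convex hull D \<Longrightarrow> \<phi> z = h z + c"
      using realization_affine[OF complex_K D(1)] by metis
    have "h (Y s) = (1 - s) *\<^sub>R h y + s *\<^sub>R h v'"
      unfolding Y_def by (simp only: linear_add[OF h(1)] linear_scale[OF h(1)])
    then show ?thesis
      unfolding h(2)[OF YK[OF that]] h(2)[OF y(1)] h(2)[OF y(2)]
      by (simp add: algebra_simps)
  qed
  have \<phi>XY: "\<phi> (X s) = \<phi> (Y s)" if "s \<in> {0..1}" for s
    using \<phi>X[OF that] \<phi>Y[OF that] eq(1,2) vert complex_verticesD(3) by simp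
  have XY: "X s \<noteq> Y s" if s: "s \<in> {0..1}" for s
  proof (cases "s = 1")
    case True
    then show ?thesis using eq(3) by (simp add: X_def Y_def)
  next
    case False
    \<comment> \<open>Moving from a relatively interior point towards any point of a convex set stays in the relative interior.\<close>
    have "v - (1 - s) *\<^sub>R (v - x) \<in> rel_interior (convex hull C)"
         "v' - (1 - s) *\<^sub>R (v' - y) \<in> rel_interior (convex hull D)"
      using s False C(2) D(2) x(2) y(2) by (auto intro!: rel_interior_convex_shrink)
    moreover have "v - (1 - s) *\<^sub>R (v - x) = X s" "v' - (1 - s) *\<^sub>R (v' - y) = Y s"
      by (simp_all add: X_def Y_def algebra_simps)
    ultimately show ?thesis
      using vertex_sets_rel_interior_eq[OF complex_K C(1) D(1)] \<open>C \<noteq> D\<close> by metis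
  qed
  define d where "d s = snd (g (X s)) - snd (g (Y s))" for s
  have gc: "continuous_on (\<Union>K) g"
    using g is_lifting_iff pl_map_continuous_on by blast
  have "continuous_on {0..1} (\<lambda>s. g (X s))"
    by (rule continuous_on_compose2[OF gc]) (use XK hull in \<open>auto simp: X_def intro!: continuous_intros\<close>)
  moreover have "continuous_on {0..1} (\<lambda>s. g (Y s))"
    by (rule continuous_on_compose2[OF gc]) (use YK hull in \<open>auto simp: Y_def intro!: continuous_intros\<close>)
  ultimately have "continuous_on {0..1} d"
    unfolding d_def by (intro continuous_intros)
  moreover have "d s \<noteq> 0" if s: "s \<in> {0..1}" for s
  proof -
    have "X s \<in> \<Union>K" "Y s \<in> \<Union>K" using XK[OF s] YK[OF s] hull by blast+
    then show ?thesis
      using g XY[OF s] \<phi>XY[OF s] unfolding is_lifting_iff d_def by auto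
  qed
  ultimately have "d 0 < 0 \<longleftrightarrow> d 1 < 0"
    by (rule continuous_nonzero_same_sign)
  then show ?thesis
    by (simp add: d_def X_def Y_def)
qed

text \<open>
  During an isotopy the heights of two distinct vertices with the same image never become equal.
\<close>
lemma isotopic_liftings_imp_vertex_order_eq:
  assumes "isotopic_liftings (\<Union>K) (\<Union>L) \<phi> g g'"
  shows "vertex_order K f g = vertex_order K f g'"
proof -
  obtain F where F: "continuous_on (\<Union>K \<times> {0..1}) F"
      "\<And>t. t \<in> {0..1} \<Longrightarrow> is_lifting (\<lambda>x. F (x, t))"
      "\<And>x. x \<in> \<Union>K \<Longrightarrow> F (x, 0) = g x" "\<And>x. x \<in> \<Union>K \<Longrightarrow> F (x, 1 :: real) = g' x"
    using assms unfolding isotopic_liftings_def by blast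
  have "snd (g v) < snd (g v') \<longleftrightarrow> snd (g' v) < snd (g' v')"
    if v: "v \<in> complex_vertices K" "v' \<in> complex_vertices K" "f v = f v'" for v v'
  proof (cases "v = v'")
    case False
    note V = complex_verticesD[OF v(1)] complex_verticesD[OF v(2)]
    define d where "d s = snd (F (v, s)) - snd (F (v', s))" for s
    have "continuous_on {0..1} (\<lambda>s. F (v, s))" "continuous_on {0..1} (\<lambda>s. F (v', s))"
      using V(2,5) by (auto intro!: continuous_on_compose2[OF F(1)] continuous_intros)
    then have "continuous_on {0..1} d"
      unfolding d_def by (intro continuous_intros)
    moreover have "d s \<noteq> 0" if s: "s \<in> {0..1}" for s
      using F(2)[OF s] False V v(3) unfolding is_lifting_iff d_def by auto
    ultimately have "d 0 < 0 \<longleftrightarrow> d 1 < 0"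
      by (rule continuous_nonzero_same_sign)
    then show ?thesis
      using F(3,4) V(2,5) by (simp add: d_def)
  qed simp
  then show ?thesis
    by (auto simp: vertex_order_def)
qed

lemma height_order_eq:
  assumes g: "is_lifting g" and g': "is_lifting g'"
    and ord: "vertex_order K f g = vertex_order K f g'"
    and xy: "x \<in> \<Union>K" "y \<in> \<Union>K" "x \<noteq> y" "\<phi> x = \<phi> y"
  shows "snd (g x) < snd (g y) \<longleftrightarrow> snd (g' x) < snd (g' y)"
proof -
  obtain C p u where C: "C \<in> vertex_sets K" "p ` C \<in> vertex_sets K" "inj_on p C"
    "\<forall>v\<in>C. f (p v) = f v" "\<forall>v\<in>C. 0 < u v" "sum u C = 1"
    "x = (\<Sum>v\<in>C. u v *\<^sub>R v)" "y = (\<Sum>v\<in>C. u v *\<^sub>R p v)" "\<exists>v\<in>C. p v \<noteq> v"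
    by (rule double_point_bijection[OF xy])
  obtain v where v: "v \<in> C" "p v \<noteq> v" using C(9) by blast
  have ri: "x \<in> rel_interior (convex hull C)"
    unfolding C(7) by (rule positive_combination_in_rel_interior[OF C(1) bspec[OF C(5)] C(6)])
  define w where "w q = u (inv_into C p q)" for q
  have w: "w (p v) = u v" if "v \<in> C" for v
    using that C(3) by (simp add: w_def)
  have w': "sum w (p ` C) = 1" "(\<Sum>q\<in>p ` C. w q *\<^sub>R q) = y" "\<And>q. q \<in> p ` C \<Longrightarrow> 0 < w q"
    using w C(5,6,8) by (auto simp: sum.reindex[OF C(3)])
  have ri': "y \<in> rel_interior (convex hull (p ` C))"
    unfolding w'(2)[symmetric] by (rule positive_combination_in_rel_interior[OF C(2) w'(3,1)])
  have vert: "v \<in> complex_vertices K" "p v \<in> complex_vertices K"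
    using vertex_sets_subset_complex_vertices[OF complex_K] C(1,2) v(1) by blast+
  have *: "snd (k x) < snd (k y) \<longleftrightarrow> snd (k v) < snd (k (p v))" if "is_lifting k" for k
    using height_order_at_vertices[OF that C(1) ri v(1) C(2) ri' _ xy(4)] bspec[OF C(4) v(1)] v by auto
  have mem: "(v, p v) \<in> vertex_order K f k \<longleftrightarrow> snd (k v) < snd (k (p v))" for k
    using vert bspec[OF C(4) v(1)] by (simp add: vertex_order_def)
  have "snd (g v) < snd (g (p v)) \<longleftrightarrow> snd (g' v) < snd (g' (p v))"
    unfolding mem[symmetric] ord ..
  then show ?thesis using *[OF g] *[OF g'] by simp
qed

text \<open>
  The straight line between the liftings is an isotopy: at any pair of double points the two height
  differences have the same sign, so no convex combination of them vanishes.
\<close>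
lemma vertex_order_eq_imp_isotopic_liftings:
  assumes g: "is_lifting g" and g': "is_lifting g'"
    and ord: "vertex_order K f g = vertex_order K f g'"
  shows "isotopic_liftings (\<Union>K) (\<Union>L) \<phi> g g'"
proof -
  define F where "F = (\<lambda>(x, t). (1 - t) *\<^sub>R g x + t *\<^sub>R g' x)"
  note G = g[unfolded is_lifting_iff] g'[unfolded is_lifting_iff]
  have c: "continuous_on (\<Union>K) g" "continuous_on (\<Union>K) g'"
    using G pl_map_continuous_on by blast+
  have "continuous_on (\<Union>K \<times> {0..1}) (\<lambda>z. g (fst z))" "continuous_on (\<Union>K \<times> {0..1}) (\<lambda>z. g' (fst z))"
    by (auto intro!: continuous_on_compose2[OF c(1)] continuous_on_compose2[OF c(2)] continuous_intros)
  then have "continuous_on (\<Union>K \<times> {0..1}) F"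
    unfolding F_def case_prod_beta by (intro continuous_intros)
  moreover have "is_lifting (\<lambda>x. F (x, t))" if t: "t \<in> {0..1}" for t
    unfolding is_lifting_iff
  proof (intro conjI ballI impI)
    show "pl_map (\<Union>K) UNIV (\<lambda>x. F (x, t))"
      using pl_map_linear_combination[of "\<Union>K" g g' "1 - t" t] G by (simp add: F_def)
    show "fst (F (x, t)) = \<phi> x" if "x \<in> \<Union>K" for x
    proof -
      have "fst (g x) = \<phi> x" "fst (g' x) = \<phi> x" using that G by blast+
      then show ?thesis by (simp add: F_def flip: scaleR_add_left)
    qed
    fix x y assume xy: "x \<in> \<Union>K" "y \<in> \<Union>K" "x \<noteq> y" "\<phi> x = \<phi> y"
    let ?a = "snd (g x) - snd (g y)" and ?b = "snd (g' x) - snd (g' y)"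
    have "?a \<noteq> 0" "?b \<noteq> 0" "?a < 0 \<longleftrightarrow> ?b < 0"
      using G xy height_order_eq[OF g g' ord xy] by auto
    then have "(?a < 0 \<and> ?b < 0) \<or> (- ?a < 0 \<and> - ?b < 0)" by linarith
    then have "(1 - t) * ?a + t * ?b \<noteq> 0"
    proof
      assume "?a < 0 \<and> ?b < 0"
      then show ?thesis
        using convex_bound_lt[of ?a 0 ?b "1 - t" t] t by auto
    next
      assume "- ?a < 0 \<and> - ?b < 0"
      then have "(1 - t) * (- ?a) + t * (- ?b) < 0"
        using convex_bound_lt[of "- ?a" 0 "- ?b" "1 - t" t] t by auto
      then show ?thesis by linarith
    qed
    then show "snd (F (x, t)) \<noteq> snd (F (y, t))"
      by (auto simp: F_def algebra_simps)
  qed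
  ultimately show ?thesis
    unfolding isotopic_liftings_def by (intro exI[of _ F]) (auto simp: F_def)
qed

lemma isotopy_classes_eq_quotient:
  "isotopy_classes (\<Union>K) (\<Union>L) \<phi> = {g. is_lifting g} //
     {(g, g'). g \<in> {g. is_lifting g} \<and> g' \<in> {g. is_lifting g} \<and> vertex_order K f g = vertex_order K f g'}"
proof -
  have iff: "isotopic_liftings (\<Union>K) (\<Union>L) \<phi> g g' \<longleftrightarrow> vertex_order K f g = vertex_order K f g'"
    if "is_lifting g" "is_lifting g'" for g g'
    using isotopic_liftings_imp_vertex_order_eq vertex_order_eq_imp_isotopic_liftings[OF that] by blast
  have "{(g, g'). is_lifting g \<and> is_lifting g' \<and> isotopic_liftings (\<Union>K) (\<Union>L) \<phi> g g'} =
      {(g, g'). g \<in> {g. is_lifting g} \<and> g' \<in> {g. is_lifting g} \<and> vertex_order K f g = vertex_order K f g'}"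
    by (auto simp: iff)
  then show ?thesis
    unfolding isotopy_classes_def by (rule arg_cong)
qed

section \<open>Extending liftings from the 1-skeleton\<close>

text \<open>
  Two edges with the same image do not cross: the order at either pair of endpoints is the order at
  the midpoints.
\<close>
lemma edge_height_order:
  assumes g: "is_lifting g"
    and e: "{v, w} \<in> vertex_sets K" "{v', w'} \<in> vertex_sets K" "f v = f v'" "f w = f w'" "v \<noteq> v'" "w \<noteq> w'"
  shows "snd (g v) < snd (g v') \<longleftrightarrow> snd (g w) < snd (g w')"
proof -
  have mid: "\<phi> (midpoint a b) = midpoint (f a) (f b)" "midpoint a b \<in> rel_interior (convex hull {a, b})"
    if ab: "{a, b} \<in> vertex_sets K" for a b
  proof -
    obtain h c where h: "linear h" "\<And>z. z \<in> convex hull {a, b} \<Longrightarrow> \<phi> z = h z + c"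
      using realization_affine[OF complex_K ab] by metis
    have mem: "a \<in> convex hull {a, b}" "b \<in> convex hull {a, b}" "midpoint a b \<in> convex hull {a, b}"
      by (auto simp flip: segment_convex_hull)
    have "a \<in> complex_vertices K" "b \<in> complex_vertices K"
      using vertex_sets_subset_complex_vertices[OF complex_K ab] by auto
    then have f: "f a = h a + c" "f b = h b + c"
      using complex_verticesD(3) h(2) mem by metis+
    show "\<phi> (midpoint a b) = midpoint (f a) (f b)"
    proof -
      have "h (midpoint a b) = midpoint (h a) (h b)"
        unfolding midpoint_def by (simp only: linear_add[OF h(1)] linear_scale[OF h(1)])
      then have "\<phi> (midpoint a b) = (1/2) *\<^sub>R h a + (1/2) *\<^sub>R h b + c"
        unfolding h(2)[OF mem(3)] by (simp add: midpoint_def scaleR_add_right)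
      also have "\<dots> = (1/2) *\<^sub>R h a + (1/2) *\<^sub>R h b + ((1/2) *\<^sub>R c + (1/2) *\<^sub>R c)"
        by (simp flip: scaleR_add_left)
      also have "\<dots> = midpoint (h a + c) (h b + c)"
        by (simp add: midpoint_def scaleR_add_right)
      finally show ?thesis using f by simp
    qed
    show "midpoint a b \<in> rel_interior (convex hull {a, b})"
      by (simp add: rel_interior_closed_segment flip: segment_convex_hull)
  qed
  have eq: "\<phi> (midpoint v w) = \<phi> (midpoint v' w')"
    using mid(1)[OF e(1)] mid(1)[OF e(2)] e(3,4) by simp
  have "snd (g (midpoint v w)) < snd (g (midpoint v' w')) \<longleftrightarrow> snd (g v) < snd (g v')"
    by (rule height_order_at_vertices[OF g e(1) mid(2)[OF e(1)] _ e(2) mid(2)[OF e(2)] _ eq]) (use e in auto)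
  moreover have "snd (g (midpoint v w)) < snd (g (midpoint v' w')) \<longleftrightarrow> snd (g w) < snd (g w')"
    by (rule height_order_at_vertices[OF g e(1) mid(2)[OF e(1)] _ e(2) mid(2)[OF e(2)] _ eq]) (use e in auto)
  ultimately show ?thesis by simp
qed

text \<open>
  For double points with common coordinates \<open>u\<close> in simplices matched by \<open>p\<close>, the difference of the
  heights is \<open>\<Sum>v. u v * (a v - a (p v))\<close>. A summand vanishes if \<open>p v = v\<close>. Any two other vertices
  span an edge, and so do their partners, hence the remaining summands all have the same strict
  sign; at least one remains because the points differ.
\<close>
lemma is_lifting_of_vertex_heights:
  assumes vert: "\<And>v v'. \<lbrakk>v \<in> complex_vertices K; v' \<in> complex_vertices K; v \<noteq> v'; f v = f v'\<rbrakk> \<Longrightarrow> a v \<noteq> a v'"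
    and edge: "\<And>v w v' w'. \<lbrakk>{v, w} \<in> vertex_sets K; {v', w'} \<in> vertex_sets K; f v = f v'; f w = f w';
        v \<noteq> v'; w \<noteq> w'\<rbrakk> \<Longrightarrow> a v < a v' \<longleftrightarrow> a w < a w'"
  shows "is_lifting (realization K (\<lambda>v. (f v, a v :: real)))"
    (is "is_lifting ?H")
  unfolding is_lifting_iff
proof (intro conjI ballI impI)
  show "pl_map (\<Union>K) UNIV ?H"
    by (rule pl_map_realization[OF complex_K])
  show "fst (?H x) = \<phi> x" for x
    by (simp add: realization_def fst_sum)
  fix x y assume xy: "x \<in> \<Union>K" "y \<in> \<Union>K" "x \<noteq> y" "\<phi> x = \<phi> y"
  obtain C p u where C: "C \<in> vertex_sets K" "p ` C \<in> vertex_sets K" "inj_on p C"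
    "\<forall>v\<in>C. f (p v) = f v" "\<forall>v\<in>C. 0 < u v" "sum u C = 1"
    "x = (\<Sum>v\<in>C. u v *\<^sub>R v)" "y = (\<Sum>v\<in>C. u v *\<^sub>R p v)" "\<exists>v\<in>C. p v \<noteq> v"
    by (rule double_point_bijection[OF xy])
  have fin: "finite C" using vertex_setsD(1)[OF C(1)] .
  have Hx: "snd (?H x) = (\<Sum>v\<in>C. u v * a v)"
    using realization_convex_combination[OF complex_K C(1) _ C(6), of "\<lambda>v. (f v, a v)"] C(5,7)
    by (simp add: snd_sum less_imp_le)
  define w where "w q = u (inv_into C p q)" for q
  have w: "w (p v) = u v" if "v \<in> C" for v
    using that C(3) by (simp add: w_def)
  have w': "sum w (p ` C) = 1" "(\<Sum>q\<in>p ` C. w q *\<^sub>R q) = y" "\<forall>q\<in>p ` C. 0 \<le> w q"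
    using w C(5,6,8) by (auto simp: sum.reindex[OF C(3)] less_imp_le)
  have Hy: "snd (?H y) = (\<Sum>v\<in>C. u v * a (p v))"
    using realization_convex_combination[OF complex_K C(2) w'(3,1), of "\<lambda>v. (f v, a v)"] w
    by (simp add: snd_sum w'(2) sum.reindex[OF C(3)])
  obtain v0 where v0: "v0 \<in> C" "p v0 \<noteq> v0" using C(9) by blast
  have V: "v \<in> complex_vertices K" "p v \<in> complex_vertices K" if "v \<in> C" for v
    using vertex_sets_subset_complex_vertices[OF complex_K] C(1,2) that by blast+
  have same: "a v < a (p v) \<longleftrightarrow> a v0 < a (p v0)" "a v \<noteq> a (p v)" if v: "v \<in> C" "p v \<noteq> v" for v
  proof -
    have "{v, v0} \<in> vertex_sets K" "{p v, p v0} \<in> vertex_sets K"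
      using v v0 by (auto intro: vertex_sets_subset[OF complex_K C(1)] vertex_sets_subset[OF complex_K C(2)])
    then show "a v < a (p v) \<longleftrightarrow> a v0 < a (p v0)"
      using edge[of v v0 "p v" "p v0"] v v0 C(4) by metis
    show "a v \<noteq> a (p v)"
      using vert[of v "p v"] V[OF v(1)] bspec[OF C(4) v(1)] v(2) by metis
  qed
  show "snd (?H x) \<noteq> snd (?H y)"
  proof (cases "a v0 < a (p v0)")
    case True
    have "a v \<le> a (p v)" if "v \<in> C" for v
      using same[OF that] True by (cases "p v = v") auto
    then have "(\<Sum>v\<in>C. u v * a v) < (\<Sum>v\<in>C. u v * a (p v))"
      using fin C(5) True v0(1) by (intro sum_strict_mono_ex1) (auto simp: less_imp_le intro!: mult_left_mono)
    then show ?thesis using Hx Hy by simp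
  next
    case False
    then have less: "a (p v0) < a v0" using same(2)[OF v0] by simp
    have "a (p v) \<le> a v" if "v \<in> C" for v
      using same[OF that] False by (cases "p v = v") auto
    then have "(\<Sum>v\<in>C. u v * a (p v)) < (\<Sum>v\<in>C. u v * a v)"
      using fin C(5) less v0(1) by (intro sum_strict_mono_ex1) (auto simp: less_imp_le intro!: mult_left_mono)
    then show ?thesis using Hx Hy by simp
  qed
qed

end

lemma simplicial_complex_skeleton:
  assumes K: "simplicial_complex K"
  shows "simplicial_complex (skeleton n K)"
proof -
  have "F \<in> skeleton n K" if "S \<in> skeleton n K" "F face_of S" for F S
    using that K aff_dim_subset[OF face_of_imp_subset[OF that(2)]]
    unfolding simplicial_complex_def skeleton_def by auto
  moreover have sub: "skeleton n K \<subseteq> K"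
    by (auto simp: skeleton_def)
  ultimately show ?thesis
    using K finite_subset[OF sub] unfolding simplicial_complex_def by (meson subsetD)
qed

lemma vertex_sets_skeleton_iff:
  "C \<in> vertex_sets (skeleton n K) \<longleftrightarrow> C \<in> vertex_sets K \<and> card C \<le> Suc n"
proof -
  have "aff_dim (convex hull C) \<le> int n \<longleftrightarrow> card C \<le> Suc n" if "\<not> affine_dependent C"
    using aff_dim_affine_independent[OF that] by (auto simp: aff_dim_convex_hull)
  then show ?thesis
    by (auto simp: vertex_sets_def skeleton_def)
qed

lemma complex_vertices_skeleton: "complex_vertices (skeleton n K) = complex_vertices K"
  by (auto simp: complex_vertices_def skeleton_def)

lemma nondegenerate_simplicial_map_skeleton:
  assumes "nondegenerate_simplicial_map K L f"
  shows "nondegenerate_simplicial_map (skeleton n K) (skeleton n L) f"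
proof -
  interpret nondegenerate_simplicial_map K L f by fact
  show ?thesis
  proof
    show "simplicial_complex (skeleton n K)" "simplicial_complex (skeleton n L)"
      using simplicial_complex_skeleton complex_K complex_L by blast+
    show "simplicial_map (skeleton n K) (skeleton n L) f"
      unfolding simplicial_map_def
    proof
      fix C assume "C \<in> vertex_sets (skeleton n K)"
      then have "C \<in> vertex_sets K" "card C \<le> Suc n"
        by (auto simp: vertex_sets_skeleton_iff)
      then show "f ` C \<in> vertex_sets (skeleton n L)"
        using image_vertex_set card_image_le[OF vertex_setsD(1), of C K f]
        by (auto simp: vertex_sets_skeleton_iff)
    qed
    show "nondegenerate (skeleton n K) f"
      by (simp add: nondegenerate_def vertex_sets_skeleton_iff inj_on_vertex_set)
  qed
qed

context nondegenerate_simplicial_map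
begin

text \<open>
  Restricting a lifting to the 1-skeleton keeps its vertex order. Conversely the vertex heights of a
  lifting over the 1-skeleton satisfy the edge condition, so their linear extension over \<open>K\<close> is a
  lifting with the same vertex order.
\<close>
lemma vertex_orders_skeleton_eq:
  "vertex_order K f ` {g. is_lifting g} = vertex_order K f `
     {g. lifting (\<Union>(skeleton 1 K)) (\<Union>(skeleton 1 L)) (realization (skeleton 1 K) f) g}"
    (is "_ ` ?A = _ ` ?B")
proof -
  interpret sk: nondegenerate_simplicial_map "skeleton 1 K" "skeleton 1 L" f
    by (rule nondegenerate_simplicial_map_skeleton) (rule nondegenerate_simplicial_map_axioms)
  have sub: "skeleton 1 K \<subseteq> K" by (auto simp: skeleton_def)
  have "?A \<subseteq> ?B"
  proof
    fix g assume "g \<in> ?A"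
    then have g: "pl_map (\<Union>K) UNIV g" "\<And>x. x \<in> \<Union>K \<Longrightarrow> fst (g x) = \<phi> x"
      "\<And>x y. \<lbrakk>x \<in> \<Union>K; y \<in> \<Union>K; x \<noteq> y; \<phi> x = \<phi> y\<rbrakk> \<Longrightarrow> snd (g x) \<noteq> snd (g y)"
      unfolding mem_Collect_eq is_lifting_iff by blast+
    note re = realization_subcomplex[OF complex_K sk.complex_K sub]
    have mem: "x \<in> \<Union>K" if "x \<in> \<Union>(skeleton 1 K)" for x using that sub by blast
    have "sk.is_lifting g"
      unfolding sk.is_lifting_iff
    proof (intro conjI ballI impI)
      show "pl_map (\<Union>(skeleton 1 K)) UNIV g"
        using pl_map_subset[OF g(1) sk.complex_K] sub by blast
    qed (use g(2,3) mem re in metis)+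
    then show "g \<in> ?B" by simp
  qed
  moreover have "\<exists>g'\<in>?A. vertex_order K f g' = vertex_order K f g" if "g \<in> ?B" for g
  proof -
    have g: "sk.is_lifting g" using that by simp
    have 1: "snd (g v) \<noteq> snd (g v')"
      if v: "v \<in> complex_vertices K" "v' \<in> complex_vertices K" "v \<noteq> v'" "f v = f v'" for v v'
    proof -
      note V = sk.complex_verticesD[unfolded complex_vertices_skeleton]
      show ?thesis
        using g[unfolded sk.is_lifting_iff] V(2,3)[OF v(1)] V(2,3)[OF v(2)] v(3,4) by metis
    qed
    have 2: "snd (g v) < snd (g v') \<longleftrightarrow> snd (g w) < snd (g w')"
      if "{v, w} \<in> vertex_sets K" "{v', w'} \<in> vertex_sets K" "f v = f v'" "f w = f w'" "v \<noteq> v'" "w \<noteq> w'"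
      for v w v' w'
      using that by (intro sk.edge_height_order[OF g]) (auto simp: vertex_sets_skeleton_iff card_insert_if)
    let ?H = "realization K (\<lambda>v. (f v, snd (g v)))"
    have "is_lifting ?H"
      using 1 2 by (intro is_lifting_of_vertex_heights) blast+
    moreover have "vertex_order K f ?H = vertex_order K f g"
      unfolding vertex_order_def using realization_vertex[OF complex_K, of _ "\<lambda>v. (f v, snd (g v))"] by auto
    ultimately show ?thesis by blast
  qed
  ultimately show ?thesis by (auto simp: image_iff) metis+
qed

end

theorem theorem3:
  fixes K :: "'a::euclidean_space set set"
    and L :: "'b::euclidean_space set set"
    and f :: "'a \<Rightarrow> 'b"
  assumes "simplicial_complex K"
    and "simplicial_complex L"
    and "simplicial_map K L f"
    and "nondegenerate K f"
  shows "(lifts_to_embedding (\<Union>K) (\<Union>L) (realization K f) \<longleftrightarrow>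
          lifts_to_embedding (\<Union>(skeleton 1 K)) (\<Union>(skeleton 1 L)) (realization (skeleton 1 K) f)) \<and>
         (\<exists>\<beta>. bij_betw \<beta>
            (isotopy_classes (\<Union>K) (\<Union>L) (realization K f))
            (isotopy_classes (\<Union>(skeleton 1 K)) (\<Union>(skeleton 1 L)) (realization (skeleton 1 K) f)))"
proof -
  interpret nondegenerate_simplicial_map K L f
    by (rule nondegenerate_simplicial_map.intro) (fact assms)+
  interpret sk: nondegenerate_simplicial_map "skeleton 1 K" "skeleton 1 L" f
    by (rule nondegenerate_simplicial_map_skeleton) (rule nondegenerate_simplicial_map_axioms)
  have ord: "vertex_order (skeleton 1 K) f = vertex_order K f"
    by (simp add: vertex_order_def fun_eq_iff complex_vertices_skeleton)
  let ?A = "{g. is_lifting g}" and ?B = "{g. sk.is_lifting g}"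
  let ?O = "vertex_order K f ` ?A"
  have O: "vertex_order K f ` ?B = ?O"
    by (rule vertex_orders_skeleton_eq[symmetric])
  have "bij_betw (\<lambda>c. {g\<in>?A. vertex_order K f g = c}) ?O (isotopy_classes (\<Union>K) (\<Union>L) \<phi>)"
    unfolding isotopy_classes_eq_quotient by (rule bij_betw_quotient_kernel)
  moreover have "bij_betw (\<lambda>c. {g\<in>?B. vertex_order K f g = c}) ?O
      (isotopy_classes (\<Union>(skeleton 1 K)) (\<Union>(skeleton 1 L)) sk.\<phi>)"
    unfolding sk.isotopy_classes_eq_quotient ord O[symmetric] by (rule bij_betw_quotient_kernel)
  ultimately have "\<exists>\<beta>. bij_betw \<beta> (isotopy_classes (\<Union>K) (\<Union>L) \<phi>)
      (isotopy_classes (\<Union>(skeleton 1 K)) (\<Union>(skeleton 1 L)) sk.\<phi>)"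
    using bij_betw_inv_into bij_betw_trans by blast
  moreover have "?A = {} \<longleftrightarrow> ?B = {}"
    using O by (metis image_is_empty)
  ultimately show ?thesis
    unfolding lifts_to_embedding_def by auto
qed

end
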